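(* For every nonempty topological space $X$, the ring $B_1(X)$ of Baire one functions on $X$ is a $P$-convex subring of $F(X)$.
   Context: $F(X)$ is the ring of all functions $X\to\mathbb{R}$ with pointwise operations, $C(X)$ its subring of continuous functions, and $\mathbb{R}(X)$ its subring of constant functions. $B_1(X)$ is the set of all pointwise limits of sequences of members of $C(X)$; it is a subring of $F(X)$. Let $A(X)$ be a subring of $F(X)$ with $\mathbb{R}(X)\subseteq A(X)$ such that $g\circ f\in A(X)$ for every continuous $g:\mathbb{R}\to\mathbb{R}$ and every $f\in A(X)$ (then $A(X)$ is a lattice-ordered ring under the pointwise order). Such an $A(X)$ is called $P$-convex if every prime ideal of $A(X)$ is absolutely convex, where an ideal $J$ of $A(X)$ is absolutely convex if $f\in A(X)$, $g\in J$ and $|f|\le |g|$ imply $f\in J$. *)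

theory Defs
  imports "HOL-Analysis.Analysis" "HOL-Algebra.Subrings" "HOL-Algebra.Ideal"
begin

text \<open>
  Real-valued functions on a space \<open>X\<close> are represented by extensional functions on
  \<open>topspace X\<close>, so that equality of functions means equality at every point of \<open>X\<close>.
\<close>

definition fun_ring :: "'a topology \<Rightarrow> ('a \<Rightarrow> real) ring" where
  "fun_ring X =
     \<lparr>carrier = topspace X \<rightarrow>\<^sub>E UNIV,
      mult = (\<lambda>f g. \<lambda>x\<in>topspace X. f x * g x),
      one = (\<lambda>x\<in>topspace X. 1),
      zero = (\<lambda>x\<in>topspace X. 0),
      add = (\<lambda>f g. \<lambda>x\<in>topspace X. f x + g x)\<rparr>"

definition continuous_funs :: "'a topology \<Rightarrow> ('a \<Rightarrow> real) set" where
  "continuous_funs X = {f \<in> carrier (fun_ring X). continuous_map X euclideanreal f}"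

definition constant_funs :: "'a topology \<Rightarrow> ('a \<Rightarrow> real) set" where
  "constant_funs X = range (\<lambda>c. \<lambda>x\<in>topspace X. c)"

definition baire_one_funs :: "'a topology \<Rightarrow> ('a \<Rightarrow> real) set" where
  "baire_one_funs X =
     {f \<in> carrier (fun_ring X).
        \<exists>u :: nat \<Rightarrow> 'a \<Rightarrow> real.
          (\<forall>n. u n \<in> continuous_funs X) \<and>
          (\<forall>x\<in>topspace X. (\<lambda>n. u n x) \<longlonglongrightarrow> f x)}"

abbreviation subfun_ring :: "'a topology \<Rightarrow> ('a \<Rightarrow> real) set \<Rightarrow> ('a \<Rightarrow> real) ring" where
  "subfun_ring X A \<equiv> (fun_ring X)\<lparr>carrier := A\<rparr>"

text \<open>
  The subrings \<open>A(X)\<close> under consideration: they contain the constants and are closed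
  under composition with continuous real functions. (\<open>subring\<close> already
  requires the unit to belong to the subset.)
\<close>

definition composition_closed_subring :: "'a topology \<Rightarrow> ('a \<Rightarrow> real) set \<Rightarrow> bool" where
  "composition_closed_subring X A \<longleftrightarrow>
     subring A (fun_ring X) \<and>
     constant_funs X \<subseteq> A \<and>
     (\<forall>g :: real \<Rightarrow> real. \<forall>f\<in>A. continuous_on UNIV g \<longrightarrow> compose (topspace X) g f \<in> A)"

definition absolutely_convex ::
    "'a topology \<Rightarrow> ('a \<Rightarrow> real) set \<Rightarrow> ('a \<Rightarrow> real) set \<Rightarrow> bool" where
  "absolutely_convex X A J \<longleftrightarrow>
     ideal J (subfun_ring X A) \<and>
     (\<forall>f\<in>A. \<forall>g\<in>J. (\<forall>x\<in>topspace X. \<bar>f x\<bar> \<le> \<bar>g x\<bar>) \<longrightarrow> f \<in> J)"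

text \<open>Prime ideals are proper, by the definition of \<open>primeideal\<close>.\<close>

definition P_convex_subring :: "'a topology \<Rightarrow> ('a \<Rightarrow> real) set \<Rightarrow> bool" where
  "P_convex_subring X A \<longleftrightarrow>
     composition_closed_subring X A \<and>
     (\<forall>P. primeideal P (subfun_ring X A) \<longrightarrow> absolutely_convex X A P)"

lemma cring_fun_ring: "cring (fun_ring X)"
proof (rule cringI)
  show "abelian_group (fun_ring X)"
  proof (rule abelian_groupI)
    fix f assume "f \<in> carrier (fun_ring X)"
    then show "\<exists>g\<in>carrier (fun_ring X). g \<oplus>\<^bsub>fun_ring X\<^esub> f = \<zero>\<^bsub>fun_ring X\<^esub>"
      by (intro bexI[of _ "\<lambda>x\<in>topspace X. - f x"]) (auto simp: fun_ring_def fun_eq_iff)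
  qed (auto simp: fun_ring_def fun_eq_iff PiE_iff extensional_def)
  show "comm_monoid (fun_ring X)"
    by (rule comm_monoidI) (auto simp: fun_ring_def fun_eq_iff PiE_iff extensional_def)
qed (auto simp: fun_ring_def fun_eq_iff distrib_right)

end

theory Submission
  imports Defs
begin

text \<open>
  Let \<open>g\<close> lie in a prime ideal \<open>P\<close> and \<open>\<bar>f\<bar> \<le> \<bar>g\<bar>\<close>. The quotient \<open>h = f\<^sup>2 / g\<close>, set to zero where
  \<open>g\<close> vanishes, is again a Baire one function; then \<open>f\<^sup>2 = h g\<close> lies in \<open>P\<close>, and so does \<open>f\<close>.
  If \<open>f\<close> and \<open>g\<close> are the limits of continuous \<open>u\<^sub>n\<close> and \<open>v\<^sub>n\<close>, then truncating \<open>u\<^sub>n\<close> to the interval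
  \<open>[-\<bar>v\<^sub>n\<bar>, \<bar>v\<^sub>n\<bar>]\<close> gives continuous \<open>w\<^sub>n\<close> that still converge to \<open>f\<close>, and
  \<open>w\<^sub>n\<^sup>2 v\<^sub>n / (v\<^sub>n\<^sup>2 + 1/n)\<close> converges to \<open>h\<close>: at the zeros of \<open>g\<close> because it is bounded by \<open>\<bar>v\<^sub>n\<bar>\<close>.
\<close>

text \<open>Members of \<open>continuous_funs X\<close> must be extensional. Restricting the
  approximants to \<open>topspace X\<close> changes neither continuity nor limits, so a witness
  sequence can be given by plain lambda terms.\<close>

lemma baire_one_funsI:
  assumes "f \<in> extensional (topspace X)"
    and "\<And>n. continuous_map X euclideanreal (u n)"
    and "\<And>x. x \<in> topspace X \<Longrightarrow> (\<lambda>n. u n x) \<longlonglongrightarrow> f x"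
  shows "f \<in> baire_one_funs X"
proof -
  have "restrict (u n) (topspace X) \<in> continuous_funs X" for n
    using assms(2)[of n]
    by (auto simp: continuous_funs_def fun_ring_def intro: continuous_map_eq)
  then show ?thesis
    unfolding baire_one_funs_def using assms(1,3)
    by (auto simp: fun_ring_def PiE_iff intro!: exI[of _ "\<lambda>n. restrict (u n) (topspace X)"])
qed

lemma baire_one_funsE:
  assumes "f \<in> baire_one_funs X"
  obtains u where "f \<in> extensional (topspace X)"
    and "\<And>n. continuous_map X euclideanreal (u n)"
    and "\<And>x. x \<in> topspace X \<Longrightarrow> (\<lambda>n. u n x) \<longlonglongrightarrow> f x"
  using assms by (auto simp: baire_one_funs_def continuous_funs_def fun_ring_def PiE_iff)

lemma constant_funs_subset_baire_one_funs: "constant_funs X \<subseteq> baire_one_funs X"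
proof -
  have "(\<lambda>x\<in>topspace X. c) \<in> baire_one_funs X" for c
    by (rule baire_one_funsI[where u = "\<lambda>_ _. c"]) auto
  then show ?thesis
    by (auto simp: constant_funs_def)
qed

lemma baire_one_funs_add:
  assumes "f \<in> baire_one_funs X" "g \<in> baire_one_funs X"
  shows "(\<lambda>x\<in>topspace X. f x + g x) \<in> baire_one_funs X"
proof -
  from assms(1) obtain u where "\<And>n. continuous_map X euclideanreal (u n)"
    "\<And>x. x \<in> topspace X \<Longrightarrow> (\<lambda>n. u n x) \<longlonglongrightarrow> f x" by (rule baire_one_funsE) blast
  moreover from assms(2) obtain v where "\<And>n. continuous_map X euclideanreal (v n)"
    "\<And>x. x \<in> topspace X \<Longrightarrow> (\<lambda>n. v n x) \<longlonglongrightarrow> g x" by (rule baire_one_funsE) blast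
  ultimately show ?thesis
    by (intro baire_one_funsI[where u = "\<lambda>n x. u n x + v n x"])
      (auto intro: tendsto_add continuous_map_add)
qed

lemma baire_one_funs_mult:
  assumes "f \<in> baire_one_funs X" "g \<in> baire_one_funs X"
  shows "(\<lambda>x\<in>topspace X. f x * g x) \<in> baire_one_funs X"
proof -
  from assms(1) obtain u where "\<And>n. continuous_map X euclideanreal (u n)"
    "\<And>x. x \<in> topspace X \<Longrightarrow> (\<lambda>n. u n x) \<longlonglongrightarrow> f x" by (rule baire_one_funsE) blast
  moreover from assms(2) obtain v where "\<And>n. continuous_map X euclideanreal (v n)"
    "\<And>x. x \<in> topspace X \<Longrightarrow> (\<lambda>n. v n x) \<longlonglongrightarrow> g x" by (rule baire_one_funsE) blast
  ultimately show ?thesis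
    by (intro baire_one_funsI[where u = "\<lambda>n x. u n x * v n x"])
      (auto intro: tendsto_mult continuous_map_real_mult)
qed

lemma baire_one_funs_compose:
  assumes "f \<in> baire_one_funs X" "continuous_on UNIV g"
  shows "compose (topspace X) g f \<in> baire_one_funs X"
proof -
  from assms(1) obtain u where u: "\<And>n. continuous_map X euclideanreal (u n)"
    "\<And>x. x \<in> topspace X \<Longrightarrow> (\<lambda>n. u n x) \<longlonglongrightarrow> f x" by (rule baire_one_funsE) blast
  have "continuous_map X euclideanreal (\<lambda>x. g (u n x))" for n
    using continuous_map_compose[OF u(1), of euclideanreal g] assms(2) by (simp add: o_def)
  moreover have "(\<lambda>n. g (u n x)) \<longlonglongrightarrow> g (f x)" if "x \<in> topspace X" for x
    using continuous_on_tendsto_compose[OF assms(2) u(2)[OF that]] by simp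
  ultimately show ?thesis
    by (intro baire_one_funsI[where u = "\<lambda>n x. g (u n x)"]) (auto simp: compose_def)
qed

text \<open>This reduces closure under additive inverses to closure under composition with the
  continuous map \<open>uminus\<close>.\<close>

lemma a_inv_fun_ring:
  assumes "f \<in> carrier (fun_ring X)"
  shows "\<ominus>\<^bsub>fun_ring X\<^esub> f = compose (topspace X) uminus f"
proof -
  interpret cring "fun_ring X" by (rule cring_fun_ring)
  show ?thesis
    by (rule minus_equality) (use assms in \<open>auto simp: fun_ring_def compose_def fun_eq_iff\<close>)
qed

lemma subring_baire_one_funs: "subring (baire_one_funs X) (fun_ring X)"
proof -
  interpret cring "fun_ring X" by (rule cring_fun_ring)
  have carrier: "baire_one_funs X \<subseteq> carrier (fun_ring X)"
    by (auto simp: baire_one_funs_def)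
  show ?thesis
  proof (rule subringI[OF carrier])
    show "\<one>\<^bsub>fun_ring X\<^esub> \<in> baire_one_funs X"
      using constant_funs_subset_baire_one_funs[of X]
      by (auto simp: fun_ring_def constant_funs_def)
  next
    fix f assume "f \<in> baire_one_funs X"
    then show "\<ominus>\<^bsub>fun_ring X\<^esub> f \<in> baire_one_funs X"
      using baire_one_funs_compose[OF _ continuous_on_minus[OF continuous_on_id]] carrier
      by (simp add: a_inv_fun_ring subset_iff)
  next
    fix f g assume "f \<in> baire_one_funs X" "g \<in> baire_one_funs X"
    then show "f \<otimes>\<^bsub>fun_ring X\<^esub> g \<in> baire_one_funs X" "f \<oplus>\<^bsub>fun_ring X\<^esub> g \<in> baire_one_funs X"
      by (simp_all add: fun_ring_def baire_one_funs_mult baire_one_funs_add)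
  qed
qed

lemma composition_closed_subring_baire_one_funs:
  "composition_closed_subring X (baire_one_funs X)"
  by (auto simp: composition_closed_subring_def subring_baire_one_funs baire_one_funs_compose
      constant_funs_subset_baire_one_funs[THEN subsetD])

text \<open>Where \<open>g\<close> vanishes, the quotient is zero by the convention \<open>a / 0 = 0\<close>.\<close>

lemma baire_one_funs_square_divide:
  assumes "f \<in> baire_one_funs X" "g \<in> baire_one_funs X"
    and le: "\<And>x. x \<in> topspace X \<Longrightarrow> \<bar>f x\<bar> \<le> \<bar>g x\<bar>"
  shows "(\<lambda>x\<in>topspace X. (f x)\<^sup>2 / g x) \<in> baire_one_funs X"
proof -
  from assms(1) obtain u where u: "\<And>n. continuous_map X euclideanreal (u n)"
    "\<And>x. x \<in> topspace X \<Longrightarrow> (\<lambda>n. u n x) \<longlonglongrightarrow> f x" by (rule baire_one_funsE) blast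
  from assms(2) obtain v where v: "\<And>n. continuous_map X euclideanreal (v n)"
    "\<And>x. x \<in> topspace X \<Longrightarrow> (\<lambda>n. v n x) \<longlonglongrightarrow> g x" by (rule baire_one_funsE) blast
  \<comment> \<open>The bound by \<open>g\<close> relates only the limits; \<open>u n\<close> itself
    may exceed \<open>v n\<close> in absolute value. Truncation gives the approximants the same
    bound.\<close>
  define w where "w n x = max (- \<bar>v n x\<bar>) (min \<bar>v n x\<bar> (u n x))" for n x
  \<comment> \<open>The added term keeps the denominator positive even at zeros of
    \<open>v n\<close>, and it vanishes in the limit. \<open>Suc n\<close> is needed since
    \<open>inverse 0 = 0\<close>.\<close>
  define h where "h n x = (w n x)\<^sup>2 * v n x / ((v n x)\<^sup>2 + inverse (real (Suc n)))" for n x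
  have pos: "(v n x)\<^sup>2 + inverse (real (Suc n)) > 0" for n x
    by (intro add_nonneg_pos) auto
  have "continuous_map X euclideanreal (w n)" for n
    unfolding w_def
    by (intro continuous_map_real_max continuous_map_real_min continuous_map_minus
        continuous_map_real_abs u v)
  then have cont: "continuous_map X euclideanreal (h n)" for n
    unfolding h_def using pos[of n]
    by (intro continuous_map_real_divide continuous_map_real_mult continuous_map_real_pow
        continuous_map_add v) (auto simp: less_le)
  have lim: "(\<lambda>n. h n x) \<longlonglongrightarrow> (f x)\<^sup>2 / g x" if x: "x \<in> topspace X" for x
  proof (cases "g x = 0")
    case True
    \<comment> \<open>The factor multiplying \<open>v n x\<close> in \<open>h n x\<close> lies
      between 0 and 1, because \<open>w n x\<close> is at most \<open>v n x\<close> in absolute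
      value.\<close>
    have "\<bar>h n x\<bar> \<le> \<bar>v n x\<bar>" for n
    proof -
      have "\<bar>w n x\<bar> \<le> \<bar>v n x\<bar>"
        by (auto simp: w_def)
      then have "(w n x)\<^sup>2 \<le> (v n x)\<^sup>2"
        by (simp add: abs_le_square_iff)
      also have "\<dots> \<le> (v n x)\<^sup>2 + inverse (real (Suc n))"
        by simp
      finally have "\<bar>v n x\<bar> * (w n x)\<^sup>2 \<le> \<bar>v n x\<bar> * ((v n x)\<^sup>2 + inverse (real (Suc n)))"
        by (rule mult_left_mono) simp
      then show ?thesis
        using pos[of n x] by (simp add: h_def abs_mult divide_le_eq mult.commute)
    qed
    moreover have "(\<lambda>n. \<bar>v n x\<bar>) \<longlonglongrightarrow> 0"
      using tendsto_rabs[OF v(2)[OF x]] True by simp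
    ultimately have "(\<lambda>n. h n x) \<longlonglongrightarrow> 0"
      by (intro Lim_null_comparison[of "\<lambda>n. h n x" "\<lambda>n. \<bar>v n x\<bar>"] always_eventually allI)
        (simp_all only: real_norm_def)
    with True show ?thesis by simp
  next
    case False
    \<comment> \<open>Truncation commutes with limits, and \<open>f x\<close> already lies between
      \<open>- \<bar>g x\<bar>\<close> and \<open>\<bar>g x\<bar>\<close>, so truncating it has no
      effect.\<close>
    have "(\<lambda>n. w n x) \<longlonglongrightarrow> max (- \<bar>g x\<bar>) (min \<bar>g x\<bar> (f x))"
      unfolding w_def by (intro tendsto_intros u v x)
    also have "max (- \<bar>g x\<bar>) (min \<bar>g x\<bar> (f x)) = f x"
      using le[OF x] by auto
    finally have "(\<lambda>n. h n x) \<longlonglongrightarrow> (f x)\<^sup>2 * g x / ((g x)\<^sup>2 + 0)"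
      unfolding h_def using False
      by (intro tendsto_intros v x LIMSEQ_inverse_real_of_nat) auto
    with False show ?thesis by (simp add: power2_eq_square)
  qed
  show ?thesis
    by (rule baire_one_funsI[where u = h]) (use cont lim in auto)
qed

lemma primeideal_baire_one_funs_absolutely_convex:
  assumes "primeideal P (subfun_ring X (baire_one_funs X))"
  shows "absolutely_convex X (baire_one_funs X) P"
proof -
  interpret primeideal P "subfun_ring X (baire_one_funs X)" by fact
  have "f \<in> P" if f: "f \<in> baire_one_funs X" and g: "g \<in> P"
    and le: "\<And>x. x \<in> topspace X \<Longrightarrow> \<bar>f x\<bar> \<le> \<bar>g x\<bar>" for f g
  proof -
    define h where "h = (\<lambda>x\<in>topspace X. (f x)\<^sup>2 / g x)"
    have "g \<in> baire_one_funs X"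
      using a_subset g by auto
    with f le have h: "h \<in> baire_one_funs X"
      unfolding h_def by (intro baire_one_funs_square_divide)
    \<comment> \<open>At a zero of \<open>g\<close> the bound forces \<open>f x = 0\<close>, so both
      sides vanish; elsewhere \<open>g x\<close> cancels.\<close>
    have "(f x)\<^sup>2 = h x * g x" if "x \<in> topspace X" for x
      using le[OF that] that by (cases "g x = 0") (auto simp: h_def)
    then have "f \<otimes>\<^bsub>fun_ring X\<^esub> f = h \<otimes>\<^bsub>fun_ring X\<^esub> g"
      by (auto simp: fun_ring_def fun_eq_iff power2_eq_square)
    with I_l_closed[OF g, of h] h have "f \<otimes>\<^bsub>fun_ring X\<^esub> f \<in> P"
      by simp
    \<comment> \<open>Primeness applied to the product of \<open>f\<close> with itself offers
      \<open>f \<in> P\<close> as both alternatives.\<close>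
    with I_prime[of f f] f show "f \<in> P"
      by simp
  qed
  with is_ideal show ?thesis
    by (auto simp: absolutely_convex_def)
qed

theorem theorem4p14:
  fixes X :: "'a topology"
  assumes "topspace X \<noteq> {}"
  shows "P_convex_subring X (baire_one_funs X)"
  by (simp add: P_convex_subring_def composition_closed_subring_baire_one_funs
      primeideal_baire_one_funs_absolutely_convex)

end
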